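(* Let $\alpha>-1$. There does not exist a sense-preserving complex-valued kernel $\alpha$-harmonic mapping $u$ on the unit disk $\mathbb{D}$ with $u(0)=0$ and $|u(z)|<1$ for all $z\in\mathbb{D}$ such that $J_{u}(0)>1$.
   Context: $\mathbb{D}$ is the open unit disk in $\mathbb{C}$. For $\alpha>-1$, a complex-valued kernel $\alpha$-harmonic mapping is a function $u\in\mathcal{C}^{2}(\mathbb{D})$, $u:\mathbb{D}\to\mathbb{C}$, satisfying $\frac{\partial}{\partial z}\left((1-|z|^{2})^{-\alpha}\frac{\partial u}{\partial\bar z}\right)=0$ in $\mathbb{D}$. It is known that these are exactly the functions given by a convergent expansion $u(z)=\sum_{k=0}^{\infty}c_{k}z^{k}+\sum_{k=1}^{\infty}c_{-k}P_{\alpha,k}(|z|^{2})\bar{z}^{k}$ with complex coefficients $\{c_k\}_{k\in\mathbb{Z}}$ satisfying $\limsup_{|k|\to\infty}|c_{k}|^{1/|k|}\le 1$, where $P_{\alpha,k}(x)=\int_{0}^{1}t^{k-1}(1-tx)^{\alpha}\,dt$ for $-1<x<1$. Such a mapping $u$, not identically constant, is called sense-preserving at $z_{0}\in\mathbb{D}$ if $u_{z}\not\equiv 0$, the function $\omega:=(\overline{u})_{z}/u_{z}$ is well defined at $z_{0}$ (possibly with a removable singularity), and $|\omega(z_{0})|<1$; it is sense-preserving in $\mathbb{D}$ if it is sense-preserving at every point of $\mathbb{D}$. Notation: $J_{u}=|u_{z}|^{2}-|u_{\bar z}|^{2}$ is the Jacobian. *)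

theory Defs
  imports "HOL-Analysis.Analysis"
begin

abbreviation unit_disk :: "complex set" where
  "unit_disk \<equiv> ball 0 1"

text \<open>Real \<open>k\<close>-fold continuous differentiability. Meant for open \<open>S\<close>, since derivatives
  are taken at full neighbourhoods.\<close>

primrec C_k_on :: "nat \<Rightarrow> ('a::real_normed_vector \<Rightarrow> 'b::real_normed_vector) \<Rightarrow> 'a set \<Rightarrow> bool" where
  "C_k_on 0 f S \<longleftrightarrow> continuous_on S f"
| "C_k_on (Suc k) f S \<longleftrightarrow>
     (\<forall>x\<in>S. f differentiable (at x)) \<and>
     (\<forall>v. C_k_on k (\<lambda>x. frechet_derivative f (at x) v) S)"

text \<open>Wirtinger derivatives \<open>u\<^sub>z = (u\<^sub>x - \<i> u\<^sub>y) / 2\<close> and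
  \<open>u\<^bsub>z-bar\<^esub> = (u\<^sub>x + \<i> u\<^sub>y) / 2\<close>; the partial derivatives are
  the values of the real derivative in the directions \<open>1\<close> and \<open>\<i>\<close>.\<close>

definition d_z :: "(complex \<Rightarrow> complex) \<Rightarrow> complex \<Rightarrow> complex" where
  "d_z u z = (frechet_derivative u (at z) 1 - \<i> * frechet_derivative u (at z) \<i>) / 2"

definition d_zbar :: "(complex \<Rightarrow> complex) \<Rightarrow> complex \<Rightarrow> complex" where
  "d_zbar u z = (frechet_derivative u (at z) 1 + \<i> * frechet_derivative u (at z) \<i>) / 2"

definition jacobian_det :: "(complex \<Rightarrow> complex) \<Rightarrow> complex \<Rightarrow> real" where
  "jacobian_det u z = (cmod (d_z u z))\<^sup>2 - (cmod (d_zbar u z))\<^sup>2"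

definition kernel_alpha_harmonic :: "real \<Rightarrow> (complex \<Rightarrow> complex) \<Rightarrow> bool" where
  "kernel_alpha_harmonic \<alpha> u \<longleftrightarrow>
     C_k_on 2 u unit_disk \<and>
     (\<forall>z\<in>unit_disk.
        d_z (\<lambda>w. complex_of_real ((1 - (cmod w)\<^sup>2) powr (-\<alpha>)) * d_zbar u w) z = 0)"

definition dilatation :: "(complex \<Rightarrow> complex) \<Rightarrow> complex \<Rightarrow> complex" where
  "dilatation u z = d_z (\<lambda>w. cnj (u w)) z / d_z u z"

text \<open>The dilatation is well defined at \<open>z\<close> with value \<open>L\<close>: either the denominator
  does not vanish at \<open>z\<close>, or \<open>z\<close> is an isolated zero of it and \<open>L\<close> is the value of
  the continuous extension across the singularity. The case distinction is needed
  because division by zero yields \<open>0\<close>.\<close>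

definition has_dilatation_at :: "(complex \<Rightarrow> complex) \<Rightarrow> complex \<Rightarrow> complex \<Rightarrow> bool" where
  "has_dilatation_at u L z \<longleftrightarrow>
     (if d_z u z \<noteq> 0 then L = dilatation u z
      else (\<forall>\<^sub>F w in at z. d_z u w \<noteq> 0) \<and> (dilatation u \<longlongrightarrow> L) (at z))"

definition sense_preserving_at :: "(complex \<Rightarrow> complex) \<Rightarrow> complex \<Rightarrow> bool" where
  "sense_preserving_at u z \<longleftrightarrow>
     \<not> u constant_on unit_disk \<and>
     (\<exists>w\<in>unit_disk. d_z u w \<noteq> 0) \<and>
     (\<exists>L. has_dilatation_at u L z \<and> cmod L < 1)"

definition sense_preserving :: "(complex \<Rightarrow> complex) \<Rightarrow> bool" where
  "sense_preserving u \<longleftrightarrow> (\<forall>z\<in>unit_disk. sense_preserving_at u z)"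

end

theory Submission
  imports Defs "HOL-Complex_Analysis.Complex_Analysis"
begin

text \<open>Let \<open>mode r\<close> be the mean over \<open>t\<close> of \<open>u (r \<zeta>) / \<zeta>\<close>, \<open>\<zeta> = exp (2 \<pi> \<i> t)\<close>. The equation says that
  the conjugate of \<open>(1 - |z|\<^sup>2) powr (-\<alpha>) * d_zbar u z\<close> is holomorphic, so by Cauchy's theorem
  the mean of \<open>d_zbar u (r \<zeta>) / \<zeta>\<^sup>2\<close> vanishes. Differentiating in \<open>r\<close> and integrating by parts
  in \<open>t\<close> then give \<open>r * mode' r = mode r\<close>, whence \<open>mode r = r * d_z u 0\<close>. As \<open>|u| < 1\<close>, letting
  \<open>r\<close> tend to 1 shows \<open>|d_z u 0| \<le> 1\<close>, which bounds the Jacobian at the origin.\<close>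

section \<open>Wirtinger calculus at a point\<close>

lemma frechet_derivative_wirtinger:
  assumes "f differentiable at z"
  shows "frechet_derivative f (at z) h = d_z f z * h + d_zbar f z * cnj h"
proof -
  let ?D = "frechet_derivative f (at z)"
  have lin: "linear ?D" using assms by (rule linear_frechet_derivative)
  have "?D h = ?D (Re h *\<^sub>R 1 + Im h *\<^sub>R \<i>)"
    by (rule arg_cong[where f = ?D]) (simp add: complex_eq_iff)
  also have "\<dots> = Re h *\<^sub>R ?D 1 + Im h *\<^sub>R ?D \<i>"
    by (simp only: linear_add[OF lin] linear_scale[OF lin])
  also have "\<dots> = d_z f z * h + d_zbar f z * cnj h"
    by (simp add: d_z_def d_zbar_def complex_eq_iff field_simps)
  finally show ?thesis .
qed

text \<open>Once the \<open>d_z\<close> part is gone, the real derivative of \<open>g\<close> is a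
  multiple of \<open>cnj h\<close>, so conjugation makes it complex linear: these are the
  Cauchy-Riemann equations for the conjugate of \<open>g\<close>.\<close>

lemma cnj_field_differentiable:
  assumes "g differentiable at z" "d_z g z = 0"
  shows "(\<lambda>w. cnj (g w)) field_differentiable at z"
proof -
  have "(g has_derivative frechet_derivative g (at z)) (at z)"
    using assms(1) frechet_derivative_works by blast
  then have "((\<lambda>w. cnj (g w)) has_derivative (\<lambda>h. cnj (frechet_derivative g (at z) h))) (at z)"
    by (rule has_derivative_cnj)
  moreover have "cnj (frechet_derivative g (at z) h) = cnj (d_zbar g z) * h" for h
    using assms by (simp add: frechet_derivative_wirtinger)
  ultimately show ?thesis
    by (auto simp: field_differentiable_def has_field_derivative_def)
qed

section \<open>The unit circle, parametrized by [0,1], and means over circles\<close>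

definition circ :: "real \<Rightarrow> complex" where
  "circ t = exp (2 * of_real pi * \<i> * of_real t)"

lemma norm_circ [simp]: "cmod (circ t) = 1"
  by (simp add: circ_def)

lemma circ_nonzero [simp]: "circ t \<noteq> 0"
  by (simp add: circ_def)

lemma cnj_circ: "cnj (circ t) = inverse (circ t)"
  by (simp add: circ_def exp_cnj flip: exp_minus)

lemma circ_0 [simp]: "circ 0 = 1" and circ_1 [simp]: "circ 1 = 1"
  by (simp_all add: circ_def)

lemma continuous_on_circ [continuous_intros]:
  "continuous_on S f \<Longrightarrow> continuous_on S (\<lambda>x. circ (f x))"
  unfolding circ_def by (intro continuous_intros)

lemma circ_has_vector_derivative:
  "(circ has_vector_derivative 2 * of_real pi * \<i> * circ t) (at t within S)"
proof -
  have "((\<lambda>z. exp (2 * of_real pi * \<i> * z)) has_field_derivative 2 * of_real pi * \<i> * circ t)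
      (at (of_real t))"
    by (auto intro!: derivative_eq_intros simp: circ_def)
  from has_vector_derivative_real_field[OF this, of S] show ?thesis
    by (simp add: circ_def[abs_def])
qed

lemma inverse_circ_has_vector_derivative:
  "((\<lambda>t. inverse (circ t)) has_vector_derivative - (2 * of_real pi * \<i> * inverse (circ t)))
     (at t within S)"
  using has_vector_derivative_cnj[OF circ_has_vector_derivative[of t S]]
  by (simp add: cnj_circ)

text \<open>Cauchy's theorem for \<open>f z * z\<close> on the circle of radius \<open>r\<close>:
  one factor \<open>circ t\<close> comes from \<open>z\<close>, the other from
  \<open>dz\<close>.\<close>

lemma mean_circle_mult_square:
  assumes "f holomorphic_on ball 0 1" "0 < r" "r < 1"
  shows "((\<lambda>t. f (of_real r * circ t) * circ t ^ 2) has_integral 0) {0..1}"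
proof -
  have "((\<lambda>z. f z * z) has_contour_integral 0) (circlepath 0 r)"
    by (rule Cauchy_theorem_disc_simple[of _ 0 1])
       (use assms in \<open>auto intro!: holomorphic_intros\<close>)
  moreover have "circlepath 0 r t = of_real r * circ t"
      "vector_derivative (circlepath 0 r) (at t) = 2 * pi * \<i> * r * circ t" for t
    by (simp add: circlepath circ_def) (simp add: vector_derivative_circlepath circ_def)
  ultimately have *: "((\<lambda>t. f (of_real r * circ t) * (of_real r * circ t) *
      (2 * pi * \<i> * r * circ t)) has_integral 0) {0..1}"
    by (simp only: has_contour_integral)
  \<comment> \<open>One \<open>r\<close> stems from \<open>z\<close>, the factor
    \<open>2 * pi * \<i> * r\<close> from \<open>dz\<close>.\<close>
  have "inverse (2 * pi * \<i> * r * r) * (x * (r * y) * (2 * pi * \<i> * r * y)) = x * y ^ 2"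
    for x y :: complex
    using \<open>0 < r\<close> by (simp add: divide_simps power2_eq_square)
  with has_integral_mult_right[OF *, of "inverse (2 * pi * \<i> * r * r)"] show ?thesis
    by simp
qed

lemma C_2_onD:
  assumes "C_k_on 2 u S" "x \<in> S"
  shows "u differentiable at x" "(\<lambda>y. frechet_derivative u (at y) v) differentiable at x"
  using assms by (auto simp: numeral_2_eq_2)

section \<open>Regularity of kernel \<alpha>-harmonic mappings and the consequence of the equation
  on circles\<close>

locale kernel_harmonic =
  fixes \<alpha> :: real and u :: "complex \<Rightarrow> complex"
  assumes harm: "kernel_alpha_harmonic \<alpha> u"
begin

lemma differentiable: "z \<in> unit_disk \<Longrightarrow> u differentiable at z"
  using harm C_2_onD(1)[of u unit_disk z] by (auto simp: kernel_alpha_harmonic_def)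

lemma differentiable_d_z: "z \<in> unit_disk \<Longrightarrow> d_z u differentiable at z"
  and differentiable_d_zbar: "z \<in> unit_disk \<Longrightarrow> d_zbar u differentiable at z"
  using harm C_2_onD(2)[of u unit_disk z]
  unfolding kernel_alpha_harmonic_def d_z_def[abs_def] d_zbar_def[abs_def] divide_inverse
  by (auto intro!: differentiable_add differentiable_diff differentiable_mult)

lemma continuous_on_d_z: "continuous_on unit_disk (d_z u)"
  and continuous_on_d_zbar: "continuous_on unit_disk (d_zbar u)"
  and continuous_on_unit_disk: "continuous_on unit_disk u"
  by (auto intro!: continuous_at_imp_continuous_on differentiable_imp_continuous_within
        differentiable_d_z differentiable_d_zbar differentiable)

lemma has_derivative_wirtinger:
  "z \<in> unit_disk \<Longrightarrow> (u has_derivative (\<lambda>h. d_z u z * h + d_zbar u z * cnj h)) (at z)"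
proof -
  assume "z \<in> unit_disk"
  then have d: "u differentiable at z" by (rule differentiable)
  then have "frechet_derivative u (at z) = (\<lambda>h. d_z u z * h + d_zbar u z * cnj h)"
    by (intro ext frechet_derivative_wirtinger)
  with d show ?thesis
    by (simp add: frechet_derivative_works)
qed

lemma has_vector_derivative_compose:
  assumes "(p has_vector_derivative p') (at t within S)" "p t \<in> unit_disk"
  shows "((\<lambda>t. u (p t)) has_vector_derivative (d_z u (p t) * p' + d_zbar u (p t) * cnj p'))
           (at t within S)"
  using has_derivative_compose[OF assms(1)[unfolded has_vector_derivative_def]
      has_derivative_wirtinger[OF assms(2)]]
  by (simp add: has_vector_derivative_def algebra_simps)

text \<open>The weight is real and radial, hence a nonzero constant on each circle, and can be
  divided out of the vanishing mean of the conjugated holomorphic function.\<close>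

lemma mean_d_zbar:
  assumes "0 < r" "r < 1"
  shows "((\<lambda>t. d_zbar u (of_real r * circ t) * inverse (circ t) ^ 2) has_integral 0) {0..1}"
proof -
  define g where "g = (\<lambda>w. complex_of_real ((1 - (cmod w)\<^sup>2) powr (-\<alpha>)) * d_zbar u w)"
  have "(\<lambda>w. cnj (g w)) field_differentiable at z" if z: "z \<in> unit_disk" for z
  proof (rule cnj_field_differentiable)
    \<comment> \<open>The inner product replaces the squared norm because it is visibly
      differentiable at the origin too; positivity of the base makes \<open>powr\<close>
      differentiable.\<close>
    have "1 - z \<bullet> z > 0"
      using z by (simp add: power2_norm_eq_inner[symmetric] abs_square_less_1)
    then have "\<exists>D. ((\<lambda>w. (1 - w \<bullet> w) powr (-\<alpha>)) has_derivative D) (at z)"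
      by (intro exI) (rule derivative_eq_intros refl | simp)+
    then obtain D where "((\<lambda>w. (1 - w \<bullet> w) powr (-\<alpha>)) has_derivative D) (at z)" ..
    from has_derivative_of_real[OF this]
    have "(\<lambda>w. complex_of_real ((1 - w \<bullet> w) powr (-\<alpha>))) differentiable at z"
      by (rule differentiableI)
    then show "g differentiable at z"
      unfolding g_def power2_norm_eq_inner
      by (intro derivative_intros differentiable_d_zbar z)
    show "d_z g z = 0"
      using harm z by (simp add: kernel_alpha_harmonic_def g_def)
  qed
  then have "(\<lambda>w. cnj (g w)) holomorphic_on ball 0 1"
    by (auto simp: holomorphic_on_open field_differentiable_def)
  \<comment> \<open>Conjugating back restores \<open>d_zbar u\<close> and turns
    \<open>circ t ^ 2\<close> into \<open>inverse (circ t) ^ 2\<close>.\<close>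
  from has_integral_cnj[THEN iffD2, OF mean_circle_mult_square[OF this assms]]
  have "((\<lambda>t. complex_of_real ((1 - r\<^sup>2) powr (-\<alpha>)) *
      (d_zbar u (of_real r * circ t) * inverse (circ t) ^ 2)) has_integral 0) {0..1}"
    by (simp add: o_def g_def norm_mult cnj_circ mult.assoc power_mult_distrib)
  note has_integral_mult_right[OF this, of "inverse (of_real ((1 - r\<^sup>2) powr (-\<alpha>)))"]
  moreover have "inverse (complex_of_real ((1 - r\<^sup>2) powr (-\<alpha>))) *
      (of_real ((1 - r\<^sup>2) powr (-\<alpha>)) * x) = x" for x
    using assms by (simp add: abs_square_eq_1 flip: mult.assoc)
  ultimately show ?thesis by simp
qed

section \<open>The Fourier coefficient of index 1 on circles, as a function of the radius\<close>

definition mode :: "real \<Rightarrow> complex" where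
  "mode r = integral {0..1} (\<lambda>t. u (of_real r * circ t) * inverse (circ t))"

lemma continuous_on_circle:
  assumes "continuous_on unit_disk f" "\<bar>r\<bar> < 1"
  shows "continuous_on S (\<lambda>t. f (of_real r * circ t))"
  by (rule continuous_on_compose2[OF assms(1)])
     (use assms(2) in \<open>auto intro!: continuous_intros simp: norm_mult\<close>)

text \<open>Used with \<open>n\<close> equal to 0 for \<open>d_z u\<close>, 1 for \<open>u\<close>
  and 2 for \<open>d_zbar u\<close>.\<close>

lemma integrable_circle:
  assumes "continuous_on unit_disk f" "\<bar>r\<bar> < 1"
  shows "(\<lambda>t. f (of_real r * circ t) * inverse (circ t) ^ n) integrable_on {0..1}"
  by (intro integrable_continuous_interval continuous_intros continuous_on_circle assms) auto

lemma mode_has_vector_derivative: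
  assumes "\<bar>r\<bar> < 1"
  shows "(mode has_vector_derivative
           integral {0..1} (\<lambda>t. d_z u (of_real r * circ t)) +
           integral {0..1} (\<lambda>t. d_zbar u (of_real r * circ t) * inverse (circ t) ^ 2)) (at r)"
proof -
  let ?U = "{-1<..<1::real}"
  let ?F = "\<lambda>r t. d_z u (of_real r * circ t) + d_zbar u (of_real r * circ t) * inverse (circ t) ^ 2"
  have "((\<lambda>r. integral (cbox 0 1) (\<lambda>t. u (of_real r * circ t) * inverse (circ t)))
      has_vector_derivative integral (cbox 0 1) (?F r)) (at r within ?U)"
  proof (rule leibniz_rule_vector_derivative)
    fix s t :: real assume s: "s \<in> ?U" and "t \<in> cbox 0 1"
    have "((\<lambda>s. complex_of_real s * circ t) has_vector_derivative circ t) (at s within ?U)"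
      by (auto intro!: derivative_eq_intros)
    from has_vector_derivative_compose[OF this] s
    have "((\<lambda>s. u (of_real s * circ t)) has_vector_derivative
        (d_z u (of_real s * circ t) * circ t + d_zbar u (of_real s * circ t) * inverse (circ t)))
        (at s within ?U)"
      by (simp add: norm_mult cnj_circ abs_less_iff)
    from has_vector_derivative_mult_left[OF this, of "inverse (circ t)"]
    show "((\<lambda>s. u (of_real s * circ t) * inverse (circ t)) has_vector_derivative ?F s t)
        (at s within ?U)"
      by (simp add: distrib_right mult.assoc power2_eq_square)
  next
    show "(\<lambda>t. u (of_real s * circ t) * inverse (circ t)) integrable_on cbox 0 1"
      if "s \<in> ?U" for s
      using that integrable_circle[OF continuous_on_unit_disk, of s 1] by auto
  next
    show "continuous_on (?U \<times> cbox 0 1) (\<lambda>(s, t). ?F s t)"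
      unfolding split_def
      by (intro continuous_intros continuous_on_compose2[OF continuous_on_d_z]
            continuous_on_compose2[OF continuous_on_d_zbar]) (auto simp: norm_mult)
  qed (use assms in auto)
  then have "(mode has_vector_derivative integral {0..1} (?F r)) (at r)"
    unfolding mode_def[abs_def] using assms
    by (simp only: at_within_open[of r ?U] open_greaterThanLessThan cbox_interval
          greaterThanLessThan_iff abs_less_iff minus_less_iff)
  moreover have "integral {0..1} (?F r) = integral {0..1} (\<lambda>t. d_z u (of_real r * circ t)) +
           integral {0..1} (\<lambda>t. d_zbar u (of_real r * circ t) * inverse (circ t) ^ 2)"
    using integrable_circle[OF continuous_on_d_z assms, of 0]
      integrable_circle[OF continuous_on_d_zbar assms, of 2]
    by (intro integral_add) auto
  ultimately show ?thesis by simp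
qed

text \<open>The \<open>t\<close>-derivative of \<open>u (r * circ t) * inverse (circ t)\<close> has
  integral zero over a full period; its \<open>d_zbar\<close> part drops out by
  \<open>mean_d_zbar\<close>.\<close>

lemma mode_by_parts:
  assumes "0 < r" "r < 1"
  shows "mode r = of_real r * integral {0..1} (\<lambda>t. d_z u (of_real r * circ t))"
proof -
  let ?z = "\<lambda>t. complex_of_real r * circ t"
  let ?c = "2 * of_real pi * \<i> :: complex"
  have "((\<lambda>t. ?c * (of_real r * (d_z u (?z t) - d_zbar u (?z t) * inverse (circ t) ^ 2)
           - u (?z t) * inverse (circ t))) has_integral
         u (?z 1) * inverse (circ 1) - u (?z 0) * inverse (circ 0)) {0..1}"
  proof (rule fundamental_theorem_of_calculus)
    fix t :: real assume "t \<in> {0..1}"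
    have "(?z has_vector_derivative of_real r * (?c * circ t)) (at t within {0..1})"
      by (intro derivative_intros circ_has_vector_derivative)
    from has_vector_derivative_mult[OF has_vector_derivative_compose[OF this]
        inverse_circ_has_vector_derivative] assms
    show "((\<lambda>t. u (?z t) * inverse (circ t)) has_vector_derivative
        ?c * (of_real r * (d_z u (?z t) - d_zbar u (?z t) * inverse (circ t) ^ 2)
           - u (?z t) * inverse (circ t))) (at t within {0..1})"
      by (simp add: norm_mult cnj_circ field_simps power2_eq_square)
  qed simp
  note has_integral_mult_right[OF this, of "inverse ?c"]
  moreover have "inverse ?c * (?c * x) = x" for x
    by (simp add: divide_simps)
  ultimately have "((\<lambda>t. of_real r * (d_z u (?z t) - d_zbar u (?z t) * inverse (circ t) ^ 2)
           - u (?z t) * inverse (circ t)) has_integral 0) {0..1}"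
    by simp
  \<comment> \<open>The same integral evaluated term by term; the subtracted 0 is the mean of the
    \<open>d_zbar\<close> term.\<close>
  moreover have "((\<lambda>t. of_real r * (d_z u (?z t) - d_zbar u (?z t) * inverse (circ t) ^ 2)
           - u (?z t) * inverse (circ t)) has_integral
      of_real r * (integral {0..1} (\<lambda>t. d_z u (?z t)) - 0) - mode r) {0..1}"
    unfolding mode_def
    using integrable_circle[OF continuous_on_d_z, of r 0]
      integrable_circle[OF continuous_on_unit_disk, of r 1] assms
    by (intro has_integral_diff has_integral_mult_right mean_d_zbar integrable_integral) auto
  ultimately have "of_real r * (integral {0..1} (\<lambda>t. d_z u (?z t)) - 0) - mode r = 0"
    by (rule has_integral_unique[symmetric])
  then show ?thesis by simp
qed

text \<open>On (0,1) the derivative of \<open>mode\<close> is the mean of \<open>d_z u\<close>,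
  which by \<open>mode_by_parts\<close> is \<open>mode r / r\<close>. So this quotient is constant,
  and its limit at 0 is the derivative of \<open>mode\<close> there.\<close>

lemma mode_eq:
  assumes "0 < r" "r < 1" "u 0 = 0"
  shows "mode r = of_real r * d_z u 0"
proof -
  have der: "(mode has_vector_derivative integral {0..1} (\<lambda>t. d_z u (of_real s * circ t))) (at s)"
    if "0 < s" "s < 1" for s
    using mode_has_vector_derivative[of s] mean_d_zbar[OF that] that
    by (simp add: integral_unique)
  have "((\<lambda>s. mode s / of_real s) has_vector_derivative 0) (at s within {0<..<1})"
    if s: "s \<in> {0<..<1}" for s
  proof -
    have "((\<lambda>s. inverse (complex_of_real s)) has_vector_derivative - inverse (of_real s ^ 2))
        (at s within {0<..<1})"
      using s by (intro has_vector_derivative_real_field)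
         (auto intro!: derivative_eq_intros simp: power2_eq_square)
    from has_vector_derivative_mult[OF has_vector_derivative_at_within[OF der] this]
      s mode_by_parts[of s]
    show ?thesis by (simp add: field_simps power2_eq_square)
  qed
  then obtain c where c: "\<And>s. s \<in> {0<..<1} \<Longrightarrow> mode s / of_real s = c"
    using has_vector_derivative_zero_constant[of "{0<..<1}" "\<lambda>s. mode s / of_real s"] by auto
  have m0: "mode 0 = 0" by (simp add: mode_def assms)
  \<comment> \<open>Radius 0 is outside the range of \<open>mean_d_zbar\<close>, but there
    \<open>d_zbar u\<close> is the constant \<open>d_zbar u 0\<close>. With \<open>f\<close>
    constant, the radius 1/2 is an arbitrary choice.\<close>
  have "((\<lambda>t. inverse (circ t) ^ 2) has_integral 0) {0..1}"
    using has_integral_cnj[THEN iffD2, OF mean_circle_mult_square[of "\<lambda>_. 1" "1/2"]]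
    by (simp add: o_def cnj_circ)
  then have "integral {0..1} (\<lambda>t. d_zbar u 0 * inverse (circ t) ^ 2) = 0"
    using has_integral_mult_right[of _ 0 _ "d_zbar u 0"] by (simp add: integral_unique)
  then have "(mode has_vector_derivative d_z u 0) (at 0)"
    using mode_has_vector_derivative[of 0] by (auto simp: integral_mult_right)
  then have "((\<lambda>s. cmod (mode s - s *\<^sub>R d_z u 0) / \<bar>s\<bar>) \<longlongrightarrow> 0) (at 0)"
    by (simp add: has_vector_derivative_def has_derivative_iff_norm m0)
  moreover have "cmod (mode s - s *\<^sub>R d_z u 0) / \<bar>s\<bar> = cmod (mode s /\<^sub>R s - d_z u 0)"
    if "s \<noteq> 0" for s
  proof -
    have "mode s /\<^sub>R s - d_z u 0 = (mode s - s *\<^sub>R d_z u 0) /\<^sub>R s"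
      using that by (simp add: scaleR_right_diff_distrib)
    then show ?thesis by (simp add: divide_inverse_commute)
  qed
  ultimately have "((\<lambda>s. cmod (mode s /\<^sub>R s - d_z u 0)) \<longlongrightarrow> 0) (at 0)"
    by (auto elim!: Lim_transform_eventually simp: eventually_at_filter)
  then have "((\<lambda>s. mode s /\<^sub>R s) \<longlongrightarrow> d_z u 0) (at 0)"
    by (rule LIM_zero_cancel[OF tendsto_norm_zero_cancel])
  \<comment> \<open>The quotient is known to equal \<open>c\<close> only for positive
    \<open>s\<close>, hence the one-sided limit.\<close>
  then have "((\<lambda>s. mode s /\<^sub>R s) \<longlongrightarrow> d_z u 0) (at_right 0)"
    by (rule Lim_at_imp_Lim_at_within)
  moreover have "((\<lambda>s. mode s /\<^sub>R s) \<longlongrightarrow> c) (at_right 0)"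
    by (intro tendsto_eventually eventually_at_rightI[of 0 1])
       (use c in \<open>auto simp: scaleR_conv_of_real field_simps\<close>)
  ultimately have "d_z u 0 = c"
    by (rule tendsto_unique[OF trivial_limit_at_right_real])
  then show ?thesis
    using c[of r] assms by (simp add: field_simps)
qed

text \<open>The integrand of \<open>mode r\<close> has modulus at most 1 on an interval of length 1,
  so \<open>r * cmod (d_z u 0)\<close> is at most 1 for every \<open>r\<close> in (0,1).\<close>

lemma norm_d_z_0_le_1:
  assumes "u 0 = 0" and bound: "\<And>z. z \<in> unit_disk \<Longrightarrow> cmod (u z) \<le> 1"
  shows "cmod (d_z u 0) \<le> 1"
proof -
  have "r * cmod (d_z u 0) \<le> 1" if r: "0 < r" "r < 1" for r
  proof -
    have "(\<lambda>t. u (of_real r * circ t) * inverse (circ t)) integrable_on {0..1}"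
      using integrable_circle[OF continuous_on_unit_disk, of r 1] r by simp
    then have "norm (mode r) \<le> 1 * Henstock_Kurzweil_Integration.content {0..1::real}"
      unfolding mode_def using bound r
      by (intro has_integral_bound_real[OF _ finite.emptyI] integrable_integral)
         (auto simp: norm_mult norm_inverse)
    then show ?thesis
      using mode_eq[OF r assms(1)] r by (simp add: norm_mult)
  qed
  then show ?thesis
    by (rule field_le_mult_one_interval)
qed

end

theorem proposition1p4:
  fixes \<alpha> :: real
  assumes "\<alpha> > -1"
  shows "\<not> (\<exists>u. kernel_alpha_harmonic \<alpha> u \<and> sense_preserving u \<and> u 0 = 0 \<and>
                (\<forall>z\<in>unit_disk. cmod (u z) < 1) \<and> jacobian_det u 0 > 1)"
proof
  assume "\<exists>u. kernel_alpha_harmonic \<alpha> u \<and> sense_preserving u \<and> u 0 = 0 \<and>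
                (\<forall>z\<in>unit_disk. cmod (u z) < 1) \<and> jacobian_det u 0 > 1"
  then obtain u where u: "kernel_alpha_harmonic \<alpha> u" "u 0 = 0"
      "\<forall>z\<in>unit_disk. cmod (u z) < 1" "jacobian_det u 0 > 1"
    by blast
  interpret kernel_harmonic \<alpha> u by unfold_locales (fact u)
  have "cmod (d_z u 0) \<le> 1"
    using u by (intro norm_d_z_0_le_1) (auto intro: less_imp_le)
  \<comment> \<open>The Jacobian is the square of \<open>cmod (d_z u 0)\<close> minus a nonnegative
    term.\<close>
  then have "jacobian_det u 0 \<le> 1"
    by (simp add: jacobian_det_def diff_le_eq add_increasing2 power_le_one)
  with u show False by simp
qed

end
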